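(* Let $F$ be a (commutative or non-commutative) algebraic formula of size $s$, depth $\Delta$, and syntactic degree $d\ge 1$, computing a polynomial $P$. Then $P$ can also be computed by an algebraic formula $F'$ of size $s$ and depth $O(\Delta+\log d)$ in which every product gate has fan-in $2$. Furthermore, if $F$ is homogeneous and/or monotone, then so is $F'$.
   Context: An algebraic formula over $\mathbb{F}[x_1,\dots,x_n]$ (or $\mathbb{F}\langle x_1,\dots,x_n\rangle$ in the non-commutative case) is a rooted tree with edges directed towards the root; leaves are labelled by variables or by the constant $1$, edges by non-zero field constants, and internal nodes by $+$ (linear combination of the children with edge weights as coefficients) or $\times$ (product of the children, in a fixed linear order in the non-commutative case). Fan-in is unbounded. Size is the number of leaves; depth is the length of a longest leaf-to-root path. Syntactic degree: a leaf labelled $1$ has syntactic degree $0$, a variable leaf $1$, a $\times$-gate the sum of its children's, a $+$-gate the maximum of its children's; the formula's syntactic degree is that of its output. A formula is homogeneous if every gate computes a homogeneous polynomial. A parse tree is defined inductively: at a $+$-gate take a parse tree of one child (with the edge), at a $\times$-gate a parse tree of each child (with the edges), a leaf is its own parse tree; it computes the product of its leaf labels and edge constants, and the formula computes the sum over all parse trees. A formula is monotone if every monomial computed by one of its parse trees has non-zero coefficient in the polynomial computed by the formula. *)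

theory Defs
  imports Complex_Main "HOL-Library.Poly_Mapping"
begin

text \<open>Children are lists of pairs (label of the edge to the child, child). A product gate multiplies
  its children in list order, which matters in the non-commutative case only.\<close>

datatype 'a formula =
    Var nat
  | One
  | Plus "('a \<times> 'a formula) list"
  | Times "('a \<times> 'a formula) list"

fun gates :: "'a formula \<Rightarrow> 'a formula set" where
  "gates (Var i) = {Var i}"
| "gates One = {One}"
| "gates (Plus cs) = insert (Plus cs) (\<Union>c\<in>set cs. gates (snd c))"
| "gates (Times cs) = insert (Times cs) (\<Union>c\<in>set cs. gates (snd c))"

text \<open>Formulas in the variables \<open>x\<^sub>1, \<dots>, x\<^sub>n\<close>: edge labels are non-zero, and \<open>Plus\<close> and \<open>Times\<close>
  are internal nodes, hence have at least one child.\<close>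

definition formula_over :: "nat \<Rightarrow> 'a::field formula \<Rightarrow> bool" where
  "formula_over n F \<longleftrightarrow>
     (\<forall>i. Var i \<in> gates F \<longrightarrow> i \<in> {1..n}) \<and>
     (\<forall>cs. Plus cs \<in> gates F \<or> Times cs \<in> gates F \<longrightarrow> cs \<noteq> [] \<and> (\<forall>c\<in>set cs. fst c \<noteq> 0))"

fun num_leaves :: "'a formula \<Rightarrow> nat" where
  "num_leaves (Var i) = 1"
| "num_leaves One = 1"
| "num_leaves (Plus cs) = (\<Sum>c\<leftarrow>cs. num_leaves (snd c))"
| "num_leaves (Times cs) = (\<Sum>c\<leftarrow>cs. num_leaves (snd c))"

fun depth :: "'a formula \<Rightarrow> nat" where
  "depth (Var i) = 0"
| "depth One = 0"
| "depth (Plus cs) = Suc (Max ((\<lambda>c. depth (snd c)) ` set cs))"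
| "depth (Times cs) = Suc (Max ((\<lambda>c. depth (snd c)) ` set cs))"

fun syn_deg :: "'a formula \<Rightarrow> nat" where
  "syn_deg (Var i) = 1"
| "syn_deg One = 0"
| "syn_deg (Plus cs) = Max ((\<lambda>c. syn_deg (snd c)) ` set cs)"
| "syn_deg (Times cs) = (\<Sum>c\<leftarrow>cs. syn_deg (snd c))"

definition product_fanin_two :: "'a formula \<Rightarrow> bool" where
  "product_fanin_two F \<longleftrightarrow> (\<forall>cs. Times cs \<in> gates F \<longrightarrow> length cs = 2)"

text \<open>A parse tree is itself a formula, in which every sum gate has exactly one child.\<close>

inductive parse_tree :: "'a formula \<Rightarrow> 'a formula \<Rightarrow> bool" where
  "parse_tree (Var i) (Var i)"
| "parse_tree One One"
| "(a, G) \<in> set cs \<Longrightarrow> parse_tree G T \<Longrightarrow> parse_tree (Plus cs) (Plus [(a, T)])"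
| "list_all2 (rel_prod (=) parse_tree) cs ts \<Longrightarrow> parse_tree (Times cs) (Times ts)"
  monos list.rel_mono_strong prod.rel_mono_strong

text \<open>Polynomials over \<open>'a\<close> are finitely supported functions \<open>'m \<Rightarrow>\<^sub>0 'a\<close>, where \<open>'m\<close> is the
  additively written monoid of monomials. The semantics is parametrised by the monomials \<open>x i\<close> of
  the variables and by the degree \<open>deg\<close> of a monomial; both are instantiated below for \<open>'a[x]\<close> and
  for \<open>'a\<langle>x\<rangle>\<close>.\<close>

fun polynomial_of :: "(nat \<Rightarrow> 'm::monoid_add) \<Rightarrow> 'a::field formula \<Rightarrow> ('m \<Rightarrow>\<^sub>0 'a)" where
  "polynomial_of x (Var i) = Poly_Mapping.single (x i) 1"
| "polynomial_of x One = 1"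
| "polynomial_of x (Plus cs) =
     (\<Sum>c\<leftarrow>cs. Poly_Mapping.single 0 (fst c) * polynomial_of x (snd c))"
| "polynomial_of x (Times cs) =
     (\<Prod>c\<leftarrow>cs. Poly_Mapping.single 0 (fst c) * polynomial_of x (snd c))"

definition homogeneous_poly :: "('m \<Rightarrow> nat) \<Rightarrow> ('m \<Rightarrow>\<^sub>0 'a::zero) \<Rightarrow> bool" where
  "homogeneous_poly deg p \<longleftrightarrow> (\<exists>k. \<forall>m\<in>Poly_Mapping.keys p. deg m = k)"

definition homogeneous :: "(nat \<Rightarrow> 'm::monoid_add) \<Rightarrow> ('m \<Rightarrow> nat) \<Rightarrow> 'a::field formula \<Rightarrow> bool" where
  "homogeneous x deg F \<longleftrightarrow> (\<forall>G\<in>gates F. homogeneous_poly deg (polynomial_of x G))"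

text \<open>The polynomial of a parse tree is the product of its leaf labels and edge constants, so that
  its support consists of the single monomial computed by the parse tree.\<close>

definition monotone_formula :: "(nat \<Rightarrow> 'm::monoid_add) \<Rightarrow> 'a::field formula \<Rightarrow> bool" where
  "monotone_formula x F \<longleftrightarrow>
     (\<forall>T. parse_tree F T \<longrightarrow>
        (\<forall>m\<in>Poly_Mapping.keys (polynomial_of x T).
           Poly_Mapping.lookup (polynomial_of x F) m \<noteq> 0))"

type_synonym c_monomial = "nat \<Rightarrow>\<^sub>0 nat"

definition c_var :: "nat \<Rightarrow> c_monomial" where
  "c_var i = Poly_Mapping.single i 1"

definition c_degree :: "c_monomial \<Rightarrow> nat" where
  "c_degree m = (\<Sum>i\<in>Poly_Mapping.keys m. Poly_Mapping.lookup m i)"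

text \<open>The free monoid of words, written additively so that \<open>nc_monomial \<Rightarrow>\<^sub>0 'a\<close> is the free
  algebra with its usual product.\<close>

datatype nc_monomial = Word (letters: "nat list")

instantiation nc_monomial :: monoid_add
begin

definition zero_nc_monomial :: nc_monomial where
  "0 = Word []"

definition plus_nc_monomial :: "nc_monomial \<Rightarrow> nc_monomial \<Rightarrow> nc_monomial" where
  "u + v = Word (letters u @ letters v)"

instance
  by standard (simp_all add: zero_nc_monomial_def plus_nc_monomial_def)

end

definition nc_var :: "nat \<Rightarrow> nc_monomial" where
  "nc_var i = Word [i]"

definition nc_degree :: "nc_monomial \<Rightarrow> nat" where
  "nc_degree u = length (letters u)"

end

theory Submission
  imports Defs "HOL-Library.Set_Algebras"
begin

text \<open>A product gate is replaced by an ordered binary tree over its children, balanced with respect to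
  their syntactic degrees, so that the extra depth at a child of degree \<open>e\<close> below a gate of degree
  \<open>d\<close> is \<open>O(1 + log (d / e))\<close>; along a path this telescopes to \<open>O(\<Delta> + log d)\<close>. Subformulas of
  degree zero carry no weight in this count. They compute constants, hence commute with everything:
  those below a common product gate are merged into one constant, which is then recomputed in depth
  at most \<open>2\<close> by a formula with the same number of leaves. The induction maintains
  \<open>2 ^ depth F' \<le> 8 ^ depth F * d\<^sup>2\<close>. For monotonicity, the replacement does not create new parse
  tree monomials; requiring only this (and not monotonicity of subformulas) makes the induction work,
  since subformulas of a monotone formula need not be monotone.\<close>

section \<open>Well-formed formulas\<close>

lemma formula_over_simps [simp]:
  "formula_over n (Var i) \<longleftrightarrow> i \<in> {1..n}"
  "formula_over n One"
  "formula_over n (Plus cs) \<longleftrightarrow> cs \<noteq> [] \<and> (\<forall>c\<in>set cs. fst c \<noteq> 0 \<and> formula_over n (snd c))"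
  "formula_over n (Times cs) \<longleftrightarrow> cs \<noteq> [] \<and> (\<forall>c\<in>set cs. fst c \<noteq> 0 \<and> formula_over n (snd c))"
  unfolding formula_over_def by (simp; blast?)+

lemma product_fanin_two_simps [simp]:
  "product_fanin_two (Var i)"
  "product_fanin_two One"
  "product_fanin_two (Plus cs) \<longleftrightarrow> (\<forall>c\<in>set cs. product_fanin_two (snd c))"
  "product_fanin_two (Times cs) \<longleftrightarrow> length cs = 2 \<and> (\<forall>c\<in>set cs. product_fanin_two (snd c))"
  unfolding product_fanin_two_def by auto

lemma homogeneous_poly_single [simp]: "homogeneous_poly deg (Poly_Mapping.single m c)"
  by (auto simp: homogeneous_poly_def)

lemma homogeneous_poly_one [simp]: "homogeneous_poly deg 1"
  by (simp flip: single_one)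

lemma homogeneous_simps [simp]:
  "homogeneous x deg (Var i)"
  "homogeneous x deg One"
  "homogeneous x deg (Plus cs) \<longleftrightarrow>
     homogeneous_poly deg (polynomial_of x (Plus cs)) \<and> (\<forall>c\<in>set cs. homogeneous x deg (snd c))"
  "homogeneous x deg (Times cs) \<longleftrightarrow>
     homogeneous_poly deg (polynomial_of x (Times cs)) \<and> (\<forall>c\<in>set cs. homogeneous x deg (snd c))"
  unfolding homogeneous_def by (auto simp del: polynomial_of.simps(3,4))

lemma homogeneous_imp_poly: "homogeneous x deg F \<Longrightarrow> homogeneous_poly deg (polynomial_of x F)"
  by (cases F) simp_all

lemma homogeneous_poly_mult:
  fixes p q :: "'m::monoid_add \<Rightarrow>\<^sub>0 'a::field"
  assumes deg: "\<And>u v. deg (u + v) = deg u + deg v"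
    and "homogeneous_poly deg p" "homogeneous_poly deg q"
  shows "homogeneous_poly deg (p * q)"
proof -
  obtain k l where "\<forall>m\<in>Poly_Mapping.keys p. deg m = k" "\<forall>m\<in>Poly_Mapping.keys q. deg m = l"
    using assms by (auto simp: homogeneous_poly_def)
  then have "\<forall>m\<in>Poly_Mapping.keys (p * q). deg m = k + l"
    using keys_mult[of p q] deg by fastforce
  then show ?thesis by (auto simp: homogeneous_poly_def)
qed

lemma num_leaves_pos: "formula_over n F \<Longrightarrow> num_leaves F \<ge> 1"
proof (induction F rule: num_leaves.induct)
  case (3 cs)
  then obtain c ds where "cs = c # ds" by (cases cs) auto
  with 3 show ?case by fastforce
next
  case (4 cs)
  then obtain c ds where "cs = c # ds" by (cases cs) auto
  with 4 show ?case by fastforce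
qed simp_all

lemma depth_child_less:
  assumes "c \<in> set cs"
  shows "depth (snd c) < depth (Plus cs)" "depth (snd c) < depth (Times cs)"
  using assms by (auto simp: less_Suc_eq_le)

text \<open>Constants are central even when variables do not commute: \<open>0\<close> is neutral on
  both sides in the monoid of monomials, and coefficients commute. The induction adds one term at a
  time.\<close>

lemma single_zero_mult_commute:
  fixes p :: "'m::monoid_add \<Rightarrow>\<^sub>0 'a::field"
  shows "Poly_Mapping.single 0 c * p = p * Poly_Mapping.single 0 c"
proof (induction p rule: update_induct)
  case const
  show ?case by simp
next
  case (update p k v)
  have "Poly_Mapping.update k v p = Poly_Mapping.single k v + p"
    using update(1)
    by (intro poly_mapping_eqI) (auto simp: lookup_update lookup_add lookup_single when_def in_keys_iff)
  with update(3) show ?case by (simp add: mult_single algebra_simps)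
qed

lemma add_singleton_zero [simp]:
  "M + {0} = (M :: 'm::monoid_add set)" "{0} + M = M"
  by (auto simp: set_plus_def)

section \<open>Monomials of parse trees\<close>

text \<open>The monomials of all parse trees, before any cancellation in the polynomial. At a
  product gate the sum is that of \<open>Set_Algebras\<close>: elementwise sums in list
  order.\<close>

fun monomials :: "(nat \<Rightarrow> 'm::monoid_add) \<Rightarrow> 'a formula \<Rightarrow> 'm set" where
  "monomials x (Var i) = {x i}"
| "monomials x One = {0}"
| "monomials x (Plus cs) = (\<Union>c\<in>set cs. monomials x (snd c))"
| "monomials x (Times cs) = (\<Sum>c\<leftarrow>cs. monomials x (snd c))"

text \<open>Product case of the next lemma, as a list induction of its own; the coefficient stays
  non-zero because a field has no zero divisors.\<close>

lemma product_of_monomials: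
  fixes x :: "nat \<Rightarrow> 'm::monoid_add" and cs :: "('a::field \<times> 'a formula) list"
  assumes "list_all2 (\<lambda>c t. fst c = fst t \<and>
      (\<exists>m\<in>monomials x (snd c). \<exists>k. k \<noteq> 0 \<and> polynomial_of x (snd t) = Poly_Mapping.single m k)) cs ts"
    and "\<forall>c\<in>set cs. fst c \<noteq> 0"
  shows "\<exists>m\<in>monomials x (Times cs). \<exists>k. k \<noteq> 0 \<and> polynomial_of x (Times ts) = Poly_Mapping.single m k"
  using assms
proof (induction rule: list_all2_induct)
  case Nil
  have "polynomial_of x (Times []) = Poly_Mapping.single 0 (1::'a)" by simp
  then show ?case by (intro bexI[of _ 0] exI[of _ 1]) auto
next
  case (Cons c cs t ts)
  then obtain m k m' k' where
    "m \<in> monomials x (snd c)" "k \<noteq> 0" "polynomial_of x (snd t) = Poly_Mapping.single m k"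
    "m' \<in> monomials x (Times cs)" "k' \<noteq> 0" "polynomial_of x (Times ts) = Poly_Mapping.single m' k'"
    by auto
  moreover have "m + m' \<in> monomials x (Times (c # cs))"
    using calculation by (auto intro: set_plus_intro)
  moreover have "polynomial_of x (Times (t # ts)) = Poly_Mapping.single (m + m') (fst t * k * k')"
    using calculation by (simp add: mult_single)
  moreover have "fst t * k * k' \<noteq> 0"
    using calculation Cons by auto
  ultimately show ?case by blast
qed

lemma parse_tree_monomial:
  fixes x :: "nat \<Rightarrow> 'm::monoid_add" and F :: "'a::field formula"
  assumes "parse_tree F T" "formula_over n F"
  shows "\<exists>m\<in>monomials x F. \<exists>k. k \<noteq> 0 \<and> polynomial_of x T = Poly_Mapping.single m k"
  using assms
proof (induction rule: parse_tree.induct)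
  case (1 i)
  show ?case by (auto intro: exI[of _ 1])
next
  case 2
  show ?case by (auto intro!: exI[of _ 1] simp flip: single_one)
next
  case (3 a G cs T)
  then have "formula_over n G" "a \<noteq> 0" by auto
  with 3 obtain m k where "m \<in> monomials x G" "k \<noteq> 0" "polynomial_of x T = Poly_Mapping.single m k"
    by blast
  moreover have "m \<in> monomials x (Plus cs)"
    using 3(1) \<open>m \<in> monomials x G\<close> by force
  ultimately show ?case using \<open>a \<noteq> 0\<close>
    by (intro bexI[of _ m] exI[of _ "a * k"]) (auto simp: mult_single)
next
  case (4 cs ts)
  have "list_all2 (\<lambda>c t. fst c = fst t \<and>
      (\<exists>m\<in>monomials x (snd c). \<exists>k. k \<noteq> 0 \<and> polynomial_of x (snd t) = Poly_Mapping.single m k)) cs ts"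
    by (rule list.rel_mono_strong[OF 4(1)]) (use 4(2) in \<open>auto simp: rel_prod_sel\<close>)
  then show ?case using 4 by (intro product_of_monomials) auto
qed

text \<open>Converse of \<open>parse_tree_monomial\<close>: a decomposition of the monomial along
  the children lets their parse trees be chosen independently.\<close>

lemma monomial_parse_tree:
  fixes x :: "nat \<Rightarrow> 'm::monoid_add" and F :: "'a::field formula"
  assumes "m \<in> monomials x F" "formula_over n F"
  shows "\<exists>T k. parse_tree F T \<and> k \<noteq> 0 \<and> polynomial_of x T = Poly_Mapping.single m k"
  using assms
proof (induction x F arbitrary: m rule: monomials.induct)
  case (1 x i)
  then show ?case by (intro exI[of _ "Var i"] exI[of _ 1]) (auto intro: parse_tree.intros)
next
  case (2 x)
  then show ?case by (intro exI[of _ One] exI[of _ 1]) (auto intro: parse_tree.intros)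
next
  case (3 x cs)
  then obtain a G where c: "(a, G) \<in> set cs" "m \<in> monomials x G" by auto
  moreover from this 3 obtain T k where
    "parse_tree G T" "k \<noteq> 0" "polynomial_of x T = Poly_Mapping.single m k"
    by fastforce
  ultimately show ?case using 3
    by (intro exI[of _ "Plus [(a, T)]"] exI[of _ "a * k"])
      (auto intro: parse_tree.intros simp: mult_single)
next
  case (4 x cs)
  \<comment> \<open>The hypothesis on the children becomes a premise, so that the list can shrink in
    the inner induction.\<close>
  have "\<exists>ts k. list_all2 (rel_prod (=) parse_tree) cs ts \<and> k \<noteq> 0 \<and>
      polynomial_of x (Times ts) = Poly_Mapping.single m k"
    if "\<And>c m. \<lbrakk>c \<in> set cs; m \<in> monomials x (snd c)\<rbrakk> \<Longrightarrow>
        \<exists>T k. parse_tree (snd c) T \<and> k \<noteq> 0 \<and> polynomial_of x T = Poly_Mapping.single m k"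
      and "\<forall>c\<in>set cs. fst c \<noteq> 0" "m \<in> monomials x (Times cs)"
    using that
  proof (induction cs arbitrary: m)
    case Nil
    then show ?case by (intro exI[of _ "[]"] exI[of _ 1]) auto
  next
    case (Cons c cs)
    from Cons.prems(3) obtain u v where uv: "m = u + v" "u \<in> monomials x (snd c)" "v \<in> monomials x (Times cs)"
      by (auto elim: set_plus_elim)
    obtain T k where T: "parse_tree (snd c) T" "k \<noteq> 0" "polynomial_of x T = Poly_Mapping.single u k"
      using Cons.prems(1)[of c u] uv by auto
    obtain ts l where ts: "list_all2 (rel_prod (=) parse_tree) cs ts" "l \<noteq> 0"
      "polynomial_of x (Times ts) = Poly_Mapping.single v l"
      using Cons.IH[of v] Cons.prems uv by auto
    have "rel_prod (=) parse_tree c (fst c, T)" using T by (simp add: rel_prod_sel)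
    then show ?case
      using T ts uv Cons.prems(2)
      by (intro exI[of _ "(fst c, T) # ts"] exI[of _ "fst c * k * l"])
        (auto simp: mult_single)
  qed
  then obtain ts k where "list_all2 (rel_prod (=) parse_tree) cs ts" "k \<noteq> 0"
      "polynomial_of x (Times ts) = Poly_Mapping.single m k"
    using 4 by (metis formula_over_simps(4))
  then show ?case by (blast intro: parse_tree.intros)
qed

text \<open>Every parse tree monomial of \<open>F'\<close> is already one of \<open>F\<close>, and
  both formulas have the same coefficients.\<close>

lemma monotone_formula_transfer:
  assumes "monotone_formula x F" "formula_over n F" "formula_over n F'"
    and "polynomial_of x F' = polynomial_of x F" "monomials x F' \<subseteq> monomials x F"
  shows "monotone_formula x F'"
  unfolding monotone_formula_def
proof (intro allI impI ballI)
  fix T m assume "parse_tree F' T" "m \<in> Poly_Mapping.keys (polynomial_of x T)"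
  then have "m \<in> monomials x F"
    using parse_tree_monomial[of F' T n x] assms by fastforce
  then obtain U k where "parse_tree F U" "k \<noteq> 0" "polynomial_of x U = Poly_Mapping.single m k"
    using monomial_parse_tree assms by blast
  then show "Poly_Mapping.lookup (polynomial_of x F') m \<noteq> 0"
    using assms unfolding monotone_formula_def by auto
qed

section \<open>Formulas of syntactic degree zero\<close>

lemma syn_deg_child:
  assumes "c \<in> set cs"
  shows "syn_deg (snd c) \<le> syn_deg (Plus cs)" "syn_deg (snd c) \<le> syn_deg (Times cs)"
  using assms by (auto intro: member_le_sum_list)

text \<open>A sum or maximum of naturals vanishes only if all its terms do, so every leaf is
  \<open>One\<close>.\<close>

lemma syn_deg_zero_monomials:
  "formula_over n F \<Longrightarrow> syn_deg F = 0 \<Longrightarrow> monomials x F = {0}"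
proof (induction F rule: num_leaves.induct)
  case (3 cs)
  then have "monomials x (snd c) = {0}" if "c \<in> set cs" for c
    using syn_deg_child(1)[OF that] that by auto
  with 3 show ?case by (auto simp: neq_Nil_conv)
next
  case (4 cs)
  \<comment> \<open>In the set algebra \<open>{0}\<close> is the neutral element \<open>0\<close>,
    so the sum over the children collapses.\<close>
  then have "\<forall>c\<in>set cs. monomials x (snd c) = 0"
    using syn_deg_child(2) by (auto simp: set_zero)
  then have "(\<Sum>c\<leftarrow>cs. monomials x (snd c)) = 0"
    by (induction cs) auto
  then show ?case by (simp add: set_zero)
qed simp_all

lemma sum_leaves_eq_1:
  assumes "(\<Sum>c\<leftarrow>cs. num_leaves (snd c)) = 1" "\<forall>c\<in>set cs. formula_over n (snd c)"
  shows "\<exists>c. cs = [c] \<and> num_leaves (snd c) = 1"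
proof (cases cs)
  case (Cons c ds)
  then have "num_leaves (snd c) \<ge> 1" using assms num_leaves_pos by auto
  moreover have "ds = []"
  proof (cases ds)
    case (Cons d es)
    then have "num_leaves (snd d) \<ge> 1" using assms \<open>cs = c # ds\<close> num_leaves_pos by auto
    then show ?thesis using calculation assms \<open>cs = c # ds\<close> Cons by auto
  qed simp
  ultimately show ?thesis using assms Cons by auto
qed (use assms in simp)

text \<open>The constant may vanish by cancellation, but not with a single leaf: then the formula is
  a chain of unary gates with non-zero labels. This clause is the condition for recomputing the
  constant in the same size.\<close>

lemma syn_deg_zero_polynomial:
  fixes x :: "nat \<Rightarrow> 'm::monoid_add" and F :: "'a::field formula"
  assumes "formula_over n F" "syn_deg F = 0"
  shows "\<exists>c. polynomial_of x F = Poly_Mapping.single 0 c \<and> (num_leaves F = 1 \<longrightarrow> c \<noteq> 0)"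
  using assms
proof (induction F rule: num_leaves.induct)
  case 2
  show ?case by (auto intro!: exI[of _ 1])
next
  case (3 cs)
  then have "\<forall>c\<in>set cs. \<exists>k. polynomial_of x (snd c) = Poly_Mapping.single 0 k \<and> (num_leaves (snd c) = 1 \<longrightarrow> k \<noteq> 0)"
    using syn_deg_child(1) by fastforce
  then obtain f where f: "\<forall>c\<in>set cs. polynomial_of x (snd c) = Poly_Mapping.single 0 (f c)
      \<and> (num_leaves (snd c) = 1 \<longrightarrow> f c \<noteq> 0)" by metis
  then have "polynomial_of x (Plus cs) = Poly_Mapping.single 0 (\<Sum>c\<leftarrow>cs. fst c * f c)"
    by (induction cs) (auto simp: mult_single single_add)
  moreover have "(\<Sum>c\<leftarrow>cs. fst c * f c) \<noteq> 0" if "num_leaves (Plus cs) = 1"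
    using sum_leaves_eq_1[of cs n] that 3 f by auto
  ultimately show ?case by blast
next
  case (4 cs)
  then have "\<forall>c\<in>set cs. \<exists>k. polynomial_of x (snd c) = Poly_Mapping.single 0 k \<and> (num_leaves (snd c) = 1 \<longrightarrow> k \<noteq> 0)"
    using syn_deg_child(2) by fastforce
  then obtain f where f: "\<forall>c\<in>set cs. polynomial_of x (snd c) = Poly_Mapping.single 0 (f c)
      \<and> (num_leaves (snd c) = 1 \<longrightarrow> f c \<noteq> 0)" by metis
  then have "polynomial_of x (Times cs) = Poly_Mapping.single 0 (\<Prod>c\<leftarrow>cs. fst c * f c)"
    by (induction cs) (auto simp: mult_single)
  moreover have "(\<Prod>c\<leftarrow>cs. fst c * f c) \<noteq> 0" if "num_leaves (Times cs) = 1"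
    using sum_leaves_eq_1[of cs n] that 4 f by auto
  ultimately show ?case by blast
qed simp

section \<open>Constants with a prescribed number of leaves\<close>

fun alternating_ones :: "'a::field \<Rightarrow> nat \<Rightarrow> ('a \<times> 'a formula) list" where
  "alternating_ones c 0 = []"
| "alternating_ones c (Suc m) = (c, One) # alternating_ones (- c) m"

lemma alternating_ones_nonzero:
  "c \<noteq> 0 \<Longrightarrow> p \<in> set (alternating_ones c m) \<Longrightarrow> fst p \<noteq> 0 \<and> snd p = One"
proof (induction m arbitrary: c)
  case (Suc m)
  then show ?case using Suc.IH[of "- c"] by auto
qed simp

lemma alternating_ones_size:
  "alternating_ones c m = [] \<longleftrightarrow> m = 0"
  "(\<Sum>p\<leftarrow>alternating_ones c m. num_leaves (snd p)) = m"
  by (induction m arbitrary: c) auto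

lemma polynomial_of_alternating_ones:
  "polynomial_of x (Plus (alternating_ones c m)) = Poly_Mapping.single 0 (if odd m then c else 0)"
  by (induction m arbitrary: c) (auto simp flip: single_add)

text \<open>What the replacement of degree-zero subformulas must satisfy; depth \<open>2\<close>
  leaves room for a sum gate below a binary product.\<close>

definition exact_size_constant :: "('m \<Rightarrow> nat) \<Rightarrow> (nat \<Rightarrow> 'm::monoid_add) \<Rightarrow> nat \<Rightarrow> 'a::field \<Rightarrow> nat \<Rightarrow> 'a formula \<Rightarrow> bool" where
  "exact_size_constant deg x n c s K \<longleftrightarrow> formula_over n K \<and> polynomial_of x K = Poly_Mapping.single 0 c \<and>
     num_leaves K = s \<and> depth K \<le> 2 \<and> product_fanin_two K \<and> homogeneous x deg K \<and> monomials x K = {0}"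

text \<open>An alternating sum of \<open>s\<close> ones computes \<open>c\<close> or \<open>0\<close> according to the parity of \<open>s\<close>;
  multiplying by one more leaf \<open>1\<close> corrects the parity. Alternation avoids any assumption on the
  size of the field.\<close>

lemma ex_exact_size_constant:
  fixes x :: "nat \<Rightarrow> 'm::monoid_add" and c :: "'a::field"
  assumes "s \<ge> 1" "s = 1 \<longrightarrow> c \<noteq> 0"
  shows "\<exists>K. exact_size_constant deg x n c s K"
proof -
  \<comment> \<open>Edge labels must be non-zero, so for \<open>c = 0\<close> the label is
    \<open>1\<close>; an even number of leaves then gives the value \<open>0\<close>.\<close>
  define A where "A m = Plus (alternating_ones (if c = 0 then 1 else c) m)" for m
  have A: "formula_over n (A m)" "num_leaves (A m) = m" "product_fanin_two (A m)" "homogeneous x deg (A m)"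
    "depth (A m) = 1" "monomials x (A m) = {0}"
    "polynomial_of x (A m) = Poly_Mapping.single 0 (if odd m then (if c = 0 then 1 else c) else 0)" if "m \<ge> 1" for m
  proof -
    let ?l = "alternating_ones (if c = 0 then 1 else c) m"
    have ne: "?l \<noteq> []" using that by (simp add: alternating_ones_size)
    have el: "\<forall>p\<in>set ?l. fst p \<noteq> 0 \<and> snd p = One"
      using alternating_ones_nonzero[of "if c = 0 then 1 else c" _ m] by auto
    show "polynomial_of x (A m) = Poly_Mapping.single 0 (if odd m then (if c = 0 then 1 else c) else 0)"
      unfolding A_def by (rule polynomial_of_alternating_ones)
    then show "homogeneous x deg (A m)" using el
      unfolding A_def by (simp del: polynomial_of.simps(3))
    show "formula_over n (A m)" "product_fanin_two (A m)" using ne el by (auto simp: A_def)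
    show "num_leaves (A m) = m" by (simp add: A_def alternating_ones_size)
    have "(\<lambda>p. depth (snd p)) ` set ?l = {0}" using ne el by (auto simp: image_iff neq_Nil_conv)
    then show "depth (A m) = 1" by (simp add: A_def)
    show "monomials x (A m) = {0}" using ne el by (auto simp: A_def neq_Nil_conv)
  qed
  show ?thesis
  proof (cases "odd s \<longleftrightarrow> c \<noteq> 0")
    case True
    then have "exact_size_constant deg x n c s (A s)"
      unfolding exact_size_constant_def using A[OF assms(1)] by auto
    then show ?thesis ..
  next
    case False
    \<comment> \<open>The parity is wrong, so one leaf is spent on a trivial factor. Here
      \<open>s = 1\<close> cannot occur: it comes with \<open>c \<noteq> 0\<close> and thus has the
      right parity.\<close>
    with assms have "s - 1 \<ge> 1" "odd (s - 1) \<longleftrightarrow> c \<noteq> 0" by (cases "s = 1"; auto)+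
    then have "exact_size_constant deg x n c s (Times [(1, A (s - 1)), (1, One)])"
      unfolding exact_size_constant_def using A[of "s - 1"] assms(1)
      by (auto simp: set_plus_def)
    then show ?thesis ..
  qed
qed

lemma syn_deg_zero_constant:
  fixes x :: "nat \<Rightarrow> 'm::monoid_add" and F :: "'a::field formula"
  assumes "formula_over n F" "syn_deg F = 0"
  shows "\<exists>c K. polynomial_of x F = Poly_Mapping.single 0 c \<and> exact_size_constant deg x n c (num_leaves F) K"
  using syn_deg_zero_polynomial[OF assms, of x] ex_exact_size_constant[OF num_leaves_pos[OF assms(1)]]
  by blast

section \<open>Reassociating products\<close>

text \<open>Binary product trees over the given list in its order, as the non-commutative case
  requires. The result is a labelled child rather than a formula, so that a single child keeps its
  label; every new gate gets label \<open>1\<close>.\<close>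

inductive reassociation :: "('a::field \<times> 'a formula) list \<Rightarrow> 'a \<times> 'a formula \<Rightarrow> bool" where
  "reassociation [c] c"
| "reassociation cs c \<Longrightarrow> reassociation ds d \<Longrightarrow> reassociation (cs @ ds) (1, Times [c, d])"

lemma reassociation_polynomial:
  "reassociation cs t \<Longrightarrow>
     Poly_Mapping.single 0 (fst t) * polynomial_of x (snd t) = polynomial_of x (Times cs)"
  by (induction rule: reassociation.induct) simp_all

lemma reassociation_formula_over:
  "reassociation cs t \<Longrightarrow> \<forall>c\<in>set cs. fst c \<noteq> 0 \<and> formula_over n (snd c) \<Longrightarrow>
     fst t \<noteq> 0 \<and> formula_over n (snd t)"
  by (induction rule: reassociation.induct) simp_all

lemma reassociation_num_leaves:
  "reassociation cs t \<Longrightarrow> num_leaves (snd t) = (\<Sum>c\<leftarrow>cs. num_leaves (snd c))"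
  by (induction rule: reassociation.induct) simp_all

lemma reassociation_product_fanin_two:
  "reassociation cs t \<Longrightarrow> \<forall>c\<in>set cs. product_fanin_two (snd c) \<Longrightarrow> product_fanin_two (snd t)"
  by (induction rule: reassociation.induct) simp_all

lemma reassociation_monomials:
  "reassociation cs t \<Longrightarrow> monomials x (snd t) = (\<Sum>c\<leftarrow>cs. monomials x (snd c))"
  by (induction rule: reassociation.induct) simp_all

text \<open>The intermediate products are new gates; they are homogeneous because, with
  \<open>deg\<close> additive, homogeneity passes to products.\<close>

lemma reassociation_homogeneous:
  assumes deg: "\<And>u v. deg (u + v) = deg u + deg v"
    and "reassociation cs t" "\<forall>c\<in>set cs. homogeneous x deg (snd c)"
  shows "homogeneous x deg (snd t)"
  using assms(2,3)
  by (induction rule: reassociation.induct)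
    (auto intro!: homogeneous_poly_mult[of deg, OF deg] homogeneous_imp_poly)

text \<open>\<open>y\<close> is an element at which the doubled prefix weight reaches the threshold.
  Doubling lets the threshold stand for half of the total weight without division.\<close>

lemma split_at_threshold:
  fixes w :: "'b \<Rightarrow> nat"
  assumes "xs \<noteq> []" "t \<le> 2 * (\<Sum>x\<leftarrow>xs. w x)"
  shows "\<exists>ys y zs. xs = ys @ y # zs \<and> 2 * (\<Sum>x\<leftarrow>ys. w x) \<le> t \<and> t \<le> 2 * (\<Sum>x\<leftarrow>ys. w x) + 2 * w y"
  using assms
proof (induction xs arbitrary: t)
  case (Cons x xs)
  show ?case
  proof (cases "t \<le> 2 * w x")
    case True
    then show ?thesis by (intro exI[of _ "[]"]) auto
  next
    case False
    \<comment> \<open>The subtraction does not truncate, as the first element alone fails to reach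
      \<open>t\<close>.\<close>
    then have "xs \<noteq> []" "t - 2 * w x \<le> 2 * (\<Sum>x\<leftarrow>xs. w x)" using Cons.prems by auto
    from Cons.IH[OF this] obtain ys y zs where "xs = ys @ y # zs"
      "2 * (\<Sum>x\<leftarrow>ys. w x) \<le> t - 2 * w x" "t - 2 * w x \<le> 2 * (\<Sum>x\<leftarrow>ys. w x) + 2 * w y" by blast
    with False show ?thesis
      by (intro exI[of _ "x # ys"] exI[of _ y] exI[of _ zs]) auto
  qed
qed simp

text \<open>Depth is bounded in exponential form throughout: a level of gates is a factor
  \<open>2\<close>, and no logarithm enters the induction.\<close>

lemma two_power_depth_Times2:
  "2 ^ depth (Times [c, d]) = 2 * max (2 ^ depth (snd c)) (2 ^ depth (snd d) :: nat)"
  by (cases "depth (snd c) \<le> depth (snd d)") (auto simp: max_def)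

text \<open>Splitting off the child at which half of the total weight is reached leaves two lists of at
  most half the weight, so that two levels of gates pay for a factor \<open>4\<close> in \<open>W\<^sup>2\<close>.\<close>

lemma ex_balanced_reassociation:
  fixes g :: "'b \<Rightarrow> 'a::field \<times> 'a formula" and w :: "'b \<Rightarrow> nat"
  assumes "cs \<noteq> []" "\<forall>c\<in>set cs. 2 ^ depth (snd (g c)) \<le> B * (w c)\<^sup>2"
  shows "\<exists>t. reassociation (map g cs) t \<and> 2 ^ depth (snd t) \<le> 4 * B * (\<Sum>c\<leftarrow>cs. w c)\<^sup>2"
  using assms
proof (induction cs rule: length_induct)
  case (1 cs)
  define W where "W = (\<Sum>c\<leftarrow>cs. w c)"
  obtain ys y zs where split: "cs = ys @ y # zs" "2 * (\<Sum>c\<leftarrow>ys. w c) \<le> W"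
      "2 * (\<Sum>c\<leftarrow>zs. w c) \<le> W"
  proof -
    have "W \<le> 2 * W" by simp
    then obtain ys y zs where *: "cs = ys @ y # zs" "2 * (\<Sum>c\<leftarrow>ys. w c) \<le> W"
        "W \<le> 2 * (\<Sum>c\<leftarrow>ys. w c) + 2 * w y"
      unfolding W_def using split_at_threshold 1(2) by blast
    moreover from *(1) have "W = (\<Sum>c\<leftarrow>ys. w c) + w y + (\<Sum>c\<leftarrow>zs. w c)" by (simp add: W_def)
    ultimately show ?thesis by (intro that[of ys y zs]) simp_all
  qed
  \<comment> \<open>The factor \<open>4\<close> of the induction hypothesis is absorbed, since the
    weight of \<open>us\<close> is at most half of \<open>W\<close> and enters squared.\<close>
  have half: "\<exists>t. reassociation (map g us) t \<and> 2 ^ depth (snd t) \<le> B * W\<^sup>2"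
    if us: "us \<noteq> []" "set us \<subseteq> set cs" "length us < length cs" "2 * (\<Sum>c\<leftarrow>us. w c) \<le> W" for us
  proof -
    have "\<forall>c\<in>set us. 2 ^ depth (snd (g c)) \<le> B * (w c)\<^sup>2"
      using 1(3) us(2) by blast
    then obtain t where t: "reassociation (map g us) t" "2 ^ depth (snd t) \<le> 4 * B * (\<Sum>c\<leftarrow>us. w c)\<^sup>2"
      using 1(1) us by blast
    have "4 * B * (\<Sum>c\<leftarrow>us. w c)\<^sup>2 = B * (2 * (\<Sum>c\<leftarrow>us. w c))\<^sup>2" by (simp add: power_mult_distrib)
    also have "\<dots> \<le> B * W\<^sup>2" using us by (intro mult_left_mono power_mono) auto
    finally show ?thesis using t order_trans by blast
  qed
  have "w y \<le> W" using split(1) by (simp add: W_def)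
  then have "B * (w y)\<^sup>2 \<le> B * W\<^sup>2" by (intro mult_left_mono power_mono) auto
  then have y: "2 ^ depth (snd (g y)) \<le> B * W\<^sup>2" using 1(3) split(1) by (auto intro: order_trans)
  have sub: "set ys \<subseteq> set cs" "set zs \<subseteq> set cs" "length ys < length cs" "length zs < length cs"
    using split(1) by auto
  \<comment> \<open>The tree is \<open>ys\<close> with \<open>y\<close>, then \<open>zs\<close>: at
    most two new gates above \<open>ys\<close> and \<open>y\<close>, one above \<open>zs\<close>.
    The child \<open>y\<close> may carry nearly all the weight, but its own bound has no factor
    \<open>4\<close>.\<close>
  obtain u where u: "reassociation (map g ys @ [g y]) u" "2 ^ depth (snd u) \<le> 2 * B * W\<^sup>2"
  proof (cases "ys = []")
    case True
    then show ?thesis using that[of "g y"] y by (auto intro: reassociation.intros)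
  next
    case False
    then obtain t where "reassociation (map g ys) t" "2 ^ depth (snd t) \<le> B * W\<^sup>2"
      using half[of ys] split(2) sub by blast
    then show ?thesis using that[of "(1, Times [t, g y])"] y
      by (auto intro!: reassociation.intros simp: two_power_depth_Times2 simp del: depth.simps)
  qed
  have "\<exists>t. reassociation (map g cs) t \<and> 2 ^ depth (snd t) \<le> 4 * B * W\<^sup>2"
  proof (cases "zs = []")
    case True
    then show ?thesis using u split(1) by (intro exI[of _ u]) simp
  next
    case False
    then obtain t where "reassociation (map g zs) t" "2 ^ depth (snd t) \<le> B * W\<^sup>2"
      using half[of zs] split(3) sub by blast
    then show ?thesis using u reassociation.intros(2)[of "map g ys @ [g y]" u "map g zs" t] split(1)
      by (intro exI[of _ "(1, Times [u, t])"])
        (auto simp: two_power_depth_Times2 simp del: depth.simps)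
  qed
  then show ?case unfolding W_def .
qed

section \<open>Depth reduction\<close>

definition simulates :: "('m \<Rightarrow> nat) \<Rightarrow> (nat \<Rightarrow> 'm::monoid_add) \<Rightarrow> nat \<Rightarrow> 'a::field formula \<Rightarrow> 'a formula \<Rightarrow> bool" where
  "simulates deg x n F F' \<longleftrightarrow> formula_over n F' \<and> polynomial_of x F' = polynomial_of x F \<and>
     num_leaves F' = num_leaves F \<and> product_fanin_two F' \<and>
     (homogeneous x deg F \<longrightarrow> homogeneous x deg F') \<and> monomials x F' \<subseteq> monomials x F"

text \<open>Constant factors are central, so they can be collected in front while the order of the
  others is kept.\<close>

lemma polynomial_of_Times_separate_constants:
  fixes x :: "nat \<Rightarrow> 'm::monoid_add" and cs :: "('a::field \<times> 'a formula) list"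
  assumes "\<forall>c\<in>set cs. Q c \<longrightarrow> (\<exists>k. polynomial_of x (snd c) = Poly_Mapping.single 0 k)"
  shows "polynomial_of x (Times cs) =
    polynomial_of x (Times (filter Q cs)) * polynomial_of x (Times (filter (\<lambda>c. \<not> Q c) cs))"
  using assms
proof (induction cs)
  case (Cons c cs)
  let ?f = "\<lambda>c. Poly_Mapping.single 0 (fst c) * polynomial_of x (snd c)"
  have IH: "(\<Prod>c\<leftarrow>cs. ?f c) = (\<Prod>c\<leftarrow>filter Q cs. ?f c) * (\<Prod>c\<leftarrow>filter (\<lambda>c. \<not> Q c) cs. ?f c)"
    using Cons by simp
  show ?case
  proof (cases "Q c")
    case True
    then have "?f c * (\<Prod>c\<leftarrow>filter Q cs. ?f c) = (\<Prod>c\<leftarrow>filter Q (c # cs). ?f c)" by simp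
    with True show ?thesis unfolding polynomial_of.simps list.map prod_list.Cons IH mult.assoc[symmetric] by simp
  next
    case False
    \<comment> \<open>The factors collected so far have a constant product, so the non-constant
      factor \<open>c\<close> can be moved past it.\<close>
    have "\<exists>k. (\<Prod>c\<leftarrow>filter Q cs. ?f c) = Poly_Mapping.single 0 k"
      using Cons.prems
    proof (induction cs)
      case Nil
      show ?case by (auto intro!: exI[of _ 1])
    next
      case (Cons c cs)
      then show ?case by (auto simp: mult_single)
    qed
    then obtain k where "(\<Prod>c\<leftarrow>filter Q cs. ?f c) = Poly_Mapping.single 0 k" ..
    then have comm: "?f c * (\<Prod>c\<leftarrow>filter Q cs. ?f c) = (\<Prod>c\<leftarrow>filter Q cs. ?f c) * ?f c"
      by (metis single_zero_mult_commute)
    have "polynomial_of x (Times (c # cs)) =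
        ?f c * (\<Prod>c\<leftarrow>filter Q cs. ?f c) * (\<Prod>c\<leftarrow>filter (\<lambda>c. \<not> Q c) cs. ?f c)"
      using IH by (simp only: polynomial_of.simps list.map prod_list.Cons mult.assoc)
    also have "\<dots> = (\<Prod>c\<leftarrow>filter Q cs. ?f c) * (?f c * (\<Prod>c\<leftarrow>filter (\<lambda>c. \<not> Q c) cs. ?f c))"
      unfolding comm by (rule mult.assoc)
    finally show ?thesis using False by simp
  qed
qed simp

lemma sum_list_set_mono:
  assumes "\<forall>c\<in>set cs. M c \<subseteq> N c"
  shows "(\<Sum>c\<leftarrow>cs. M c) \<subseteq> (\<Sum>c\<leftarrow>cs. N c :: 'm::monoid_add set)"
  using assms by (induction cs) (simp_all add: set_plus_mono2)

text \<open>Used twice when degree-zero children are dropped: for syntactic degrees, and for sets of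
  monomials, where \<open>0\<close> is \<open>{0}\<close>.\<close>

lemma sum_list_filter_zero:
  assumes "\<forall>c\<in>set cs. \<not> Q c \<longrightarrow> f c = (0::'b::monoid_add)"
  shows "(\<Sum>c\<leftarrow>filter Q cs. f c) = (\<Sum>c\<leftarrow>cs. f c)"
  using assms by (induction cs) auto

lemma sum_list_filter_partition:
  "(\<Sum>c\<leftarrow>filter Q cs. f c) + (\<Sum>c\<leftarrow>filter (\<lambda>c. \<not> Q c) cs. f c) = (\<Sum>c\<leftarrow>cs. f c :: nat)"
  by (induction cs) auto

text \<open>A constant takes depth at most \<open>2\<close>, and \<open>2 ^ 2 \<le> 8\<close>, so
  one level of the original depth pays for it.\<close>

lemma simulates_exact_size_constant:
  fixes x :: "nat \<Rightarrow> 'm::monoid_add" and F :: "'a::field formula"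
  assumes "formula_over n F" "syn_deg F = 0" "depth F \<ge> 1"
  shows "\<exists>F'. simulates deg x n F F' \<and> 2 ^ depth F' \<le> (8::nat) ^ depth F"
proof -
  obtain c K where K: "polynomial_of x F = Poly_Mapping.single 0 c"
    "exact_size_constant deg x n c (num_leaves F) K"
    using syn_deg_zero_constant[OF assms(1,2)] by blast
  have "(2::nat) ^ depth K \<le> 2 ^ 2"
    using K(2) by (intro power_increasing) (auto simp: exact_size_constant_def)
  also have "\<dots> \<le> 8 ^ 1" by simp
  also have "\<dots> \<le> 8 ^ depth F" using assms(3) by (intro power_increasing) auto
  finally have "2 ^ depth K \<le> (8::nat) ^ depth F" .
  moreover have "simulates deg x n F K"
    using K syn_deg_zero_monomials[OF assms(1,2), of x]
    by (auto simp: simulates_def exact_size_constant_def)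
  ultimately show ?thesis by blast
qed

text \<open>The sum gate is kept. Its level costs a factor \<open>2\<close> where one level of the
  original depth allows \<open>8\<close>, and no child has larger degree than the gate.\<close>

lemma simulation_Plus:
  assumes F: "formula_over n (Plus cs)"
    and f: "\<forall>c\<in>set cs. simulates deg x n (snd c) (f c)"
      "\<forall>c\<in>set cs. 2 ^ depth (f c) \<le> 8 ^ depth (snd c) * (max 1 (syn_deg (snd c)))\<^sup>2"
  shows "\<exists>F'. simulates deg x n (Plus cs) F' \<and>
    2 ^ depth F' \<le> 8 ^ depth (Plus cs) * (max 1 (syn_deg (Plus cs)))\<^sup>2"
proof -
  let ?F' = "Plus (map (\<lambda>c. (fst c, f c)) cs)"
  have poly: "polynomial_of x ?F' = polynomial_of x (Plus cs)"
    using f(1) by (auto simp: simulates_def comp_def intro!: arg_cong[of _ _ sum_list])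
  have leaves: "num_leaves ?F' = num_leaves (Plus cs)"
    using f(1) by (auto simp: simulates_def comp_def intro!: arg_cong[of _ _ sum_list])
  have "homogeneous x deg ?F'" if "homogeneous x deg (Plus cs)"
    using that f(1) poly by (auto simp: simulates_def simp del: polynomial_of.simps)
  then have sim: "simulates deg x n (Plus cs) ?F'"
    unfolding simulates_def using F f(1) poly leaves
    by (auto simp: simulates_def simp del: polynomial_of.simps num_leaves.simps homogeneous_simps)
  have "(MAX c\<in>set cs. depth (f c)) \<in> (\<lambda>c. depth (f c)) ` set cs"
    using F by (intro Max_in) auto
  then obtain c where c: "c \<in> set cs" "depth ?F' = Suc (depth (f c))"
    by (auto simp: image_image)
  have "2 ^ depth ?F' = 2 * 2 ^ depth (f c)" using c by simp
  also have "\<dots> \<le> 8 * (8 ^ depth (snd c) * (max 1 (syn_deg (snd c)))\<^sup>2)"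
    using f(2) c(1) by (intro mult_mono) auto
  also have "\<dots> = 8 ^ Suc (depth (snd c)) * (max 1 (syn_deg (snd c)))\<^sup>2" by simp
  also have "\<dots> \<le> 8 ^ depth (Plus cs) * (max 1 (syn_deg (Plus cs)))\<^sup>2"
    using depth_child_less(1)[OF c(1)] syn_deg_child(1)[OF c(1)]
    by (intro mult_mono power_mono power_increasing) auto
  finally show ?thesis using sim by blast
qed

text \<open>One level of the original depth allows a factor \<open>8\<close>: the balanced tree over
  the children of positive degree, weighted by degree, takes \<open>4\<close>, and one gate on top
  takes \<open>2\<close>. The degree-zero children become a single factor in front.\<close>

lemma simulation_Times:
  fixes x :: "nat \<Rightarrow> 'm::monoid_add" and cs :: "('a::field \<times> 'a formula) list"
  assumes deg: "\<And>u v. deg (u + v) = deg u + deg v"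
    and F: "formula_over n (Times cs)" "syn_deg (Times cs) \<noteq> 0"
    and f: "\<forall>c\<in>set cs. simulates deg x n (snd c) (f c)"
      "\<forall>c\<in>set cs. 2 ^ depth (f c) \<le> 8 ^ depth (snd c) * (max 1 (syn_deg (snd c)))\<^sup>2"
  shows "\<exists>F'. simulates deg x n (Times cs) F' \<and>
    2 ^ depth F' \<le> 8 ^ depth (Times cs) * (max 1 (syn_deg (Times cs)))\<^sup>2"
proof -
  define Q where "Q c \<longleftrightarrow> syn_deg (snd c) = 0" for c :: "'a \<times> 'a formula"
  define cs0 where "cs0 = filter Q cs"
  define cs1 where "cs1 = filter (\<lambda>c. \<not> Q c) cs"
  define g where "g c = (fst c, f c)" for c
  define e where "e = depth (Times cs) - 1"
  have e: "depth (Times cs) = Suc e" by (simp add: e_def)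
  define d where "d = syn_deg (Times cs)"
  have sub: "set cs0 \<subseteq> set cs" "set cs1 \<subseteq> set cs" by (auto simp: cs0_def cs1_def)
  have F1: "\<forall>c\<in>set cs1. fst c \<noteq> 0 \<and> formula_over n (snd c)" using F(1) sub by auto
  have f1: "\<forall>c\<in>set cs1. simulates deg x n (snd c) (f c)" using f(1) sub by auto
  have d: "d = (\<Sum>c\<leftarrow>cs1. syn_deg (snd c))"
    unfolding d_def cs1_def by (subst sum_list_filter_zero) (auto simp: Q_def)
  have "cs1 \<noteq> []" using F(2) d unfolding d_def by (metis list.simps(8) sum_list.Nil)
  \<comment> \<open>Positive degree makes \<open>max 1\<close> disappear, so that the weights add up
    to exactly \<open>d\<close>.\<close>
  have "2 ^ depth (f c) \<le> 8 ^ e * (syn_deg (snd c))\<^sup>2" if "c \<in> set cs1" for c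
  proof -
    have c: "c \<in> set cs" "max 1 (syn_deg (snd c)) = syn_deg (snd c)"
      using that by (auto simp: cs1_def Q_def)
    have "2 ^ depth (f c) \<le> 8 ^ depth (snd c) * (syn_deg (snd c))\<^sup>2"
      using f(2) c by metis
    also have "\<dots> \<le> 8 ^ e * (syn_deg (snd c))\<^sup>2"
      using depth_child_less(2)[OF c(1)] e by (intro mult_right_mono power_increasing) auto
    finally show ?thesis .
  qed
  then obtain t where t: "reassociation (map g cs1) t" "2 ^ depth (snd t) \<le> 4 * 8 ^ e * d\<^sup>2"
    using ex_balanced_reassociation[of cs1 g "8 ^ e" "\<lambda>c. syn_deg (snd c)"] \<open>cs1 \<noteq> []\<close> d
    by (auto simp: g_def)
  have t_poly: "Poly_Mapping.single 0 (fst t) * polynomial_of x (snd t) = polynomial_of x (Times cs1)"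
    unfolding reassociation_polynomial[OF t(1)] using f1
    by (auto simp: g_def simulates_def comp_def intro!: arg_cong[of _ _ prod_list])
  have t_over: "fst t \<noteq> 0" "formula_over n (snd t)"
    using reassociation_formula_over[OF t(1), of n] F1 f1
    by (auto simp: g_def simulates_def)
  have t_leaves: "num_leaves (snd t) = num_leaves (Times cs1)"
    unfolding reassociation_num_leaves[OF t(1)] using f1
    by (auto simp: g_def simulates_def comp_def intro!: arg_cong[of _ _ sum_list])
  have t_fanin: "product_fanin_two (snd t)"
    using reassociation_product_fanin_two[OF t(1)] f1
    by (auto simp: g_def simulates_def)
  have t_hom: "homogeneous x deg (snd t)" if "homogeneous x deg (Times cs)"
  proof -
    have "\<forall>c\<in>set cs1. homogeneous x deg (snd c)" using that sub by auto
    then show ?thesis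
      using reassociation_homogeneous[of deg, OF deg t(1), of x] f1
      by (auto simp: g_def simulates_def)
  qed
  have "monomials x (snd t) \<subseteq> (\<Sum>c\<leftarrow>cs1. monomials x (snd c))"
    unfolding reassociation_monomials[OF t(1)] map_map using f1
    by (intro sum_list_set_mono) (auto simp: g_def simulates_def)
  also have "\<dots> = monomials x (Times cs)"
    unfolding cs1_def monomials.simps using F(1) syn_deg_zero_monomials
    by (intro sum_list_filter_zero) (auto simp: Q_def set_zero)
  finally have t_mons: "monomials x (snd t) \<subseteq> monomials x (Times cs)" .
  have poly: "polynomial_of x (Times cs) = polynomial_of x (Times cs0) * polynomial_of x (Times cs1)"
    unfolding cs0_def cs1_def
    by (rule polynomial_of_Times_separate_constants) (use F(1) syn_deg_zero_polynomial Q_def in fastforce)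
  have leaves: "num_leaves (Times cs) = num_leaves (Times cs0) + num_leaves (Times cs1)"
    unfolding cs0_def cs1_def num_leaves.simps sum_list_filter_partition ..
  have "d \<ge> 1" using F(2) unfolding d_def by linarith
  have bound: "8 ^ depth (Times cs) * (max 1 (syn_deg (Times cs)))\<^sup>2 = 8 * (8 ^ e * d\<^sup>2)"
    using \<open>d \<ge> 1\<close> e by (simp add: d_def[symmetric] max_def del: depth.simps syn_deg.simps)
  show ?thesis
  proof (cases "cs0 = []")
    case True
    \<comment> \<open>The edge to \<open>t\<close> may carry a label other than \<open>1\<close>, so
      some gate must hold it; a unary sum adds neither leaves nor product gates.\<close>
    let ?F' = "Plus [t]"
    have "polynomial_of x ?F' = polynomial_of x (Times cs)"
      using poly t_poly True by simp
    then have "simulates deg x n (Times cs) ?F'"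
      unfolding simulates_def using t_over leaves t_leaves True t_fanin t_hom t_mons
      by (auto dest: homogeneous_imp_poly simp del: polynomial_of.simps)
    moreover have "2 ^ depth ?F' \<le> 8 * (8 ^ e * d\<^sup>2)" using t(2) by (simp add: mult_ac)
    ultimately show ?thesis using bound by metis
  next
    case False
    have "formula_over n (Times cs0)" using F(1) sub False by auto
    moreover have "syn_deg (Times cs0) = 0" by (simp add: cs0_def Q_def)
    ultimately obtain c K where K: "polynomial_of x (Times cs0) = Poly_Mapping.single 0 c"
      "exact_size_constant deg x n c (num_leaves (Times cs0)) K"
      using syn_deg_zero_constant by blast
    let ?F' = "Times [(1, K), t]"
    have "polynomial_of x ?F' = polynomial_of x (Times cs)"
      using poly t_poly K by (simp add: exact_size_constant_def del: polynomial_of.simps(4))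
         (simp add: exact_size_constant_def)
    then have "simulates deg x n (Times cs) ?F'"
      unfolding simulates_def using t_over leaves t_leaves K(2) t_fanin t_hom t_mons
      by (auto simp: exact_size_constant_def dest: homogeneous_imp_poly
          simp del: polynomial_of.simps)
    moreover have "2 ^ depth ?F' \<le> 8 * (8 ^ e * d\<^sup>2)"
    proof -
      \<comment> \<open>The constant stays within the bound already granted to \<open>t\<close>, so
        only the top gate adds to it.\<close>
      have "(2::nat) ^ depth K \<le> 2 ^ 2"
        using K(2) by (intro power_increasing) (auto simp: exact_size_constant_def)
      also have "\<dots> \<le> 4 * (8 ^ e * d\<^sup>2)" using \<open>d \<ge> 1\<close> by simp
      finally show ?thesis using t(2) by (simp add: two_power_depth_Times2 mult_ac del: depth.simps)
    qed
    ultimately show ?thesis using bound by metis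
  qed
qed

text \<open>\<open>max 1\<close> extends the bound to degree zero. A product of degree zero has no
  child of positive degree to balance and is replaced as a whole; sums of degree zero follow the
  general case.\<close>

lemma ex_simulation:
  fixes x :: "nat \<Rightarrow> 'm::monoid_add" and F :: "'a::field formula"
  assumes deg: "\<And>u v. deg (u + v) = deg u + deg v" and "formula_over n F"
  shows "\<exists>F'. simulates deg x n F F' \<and> 2 ^ depth F' \<le> 8 ^ depth F * (max 1 (syn_deg F))\<^sup>2"
  using assms(2)
proof (induction F rule: num_leaves.induct)
  case (1 i)
  then show ?case by (intro exI[of _ "Var i"]) (auto simp: simulates_def)
next
  case 2
  show ?case by (intro exI[of _ One]) (auto simp: simulates_def)
next
  case (3 cs)
  then obtain f where "\<forall>c\<in>set cs. simulates deg x n (snd c) (f c)"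
      "\<forall>c\<in>set cs. 2 ^ depth (f c) \<le> 8 ^ depth (snd c) * (max 1 (syn_deg (snd c)))\<^sup>2"
    unfolding formula_over_simps by metis
  with 3 show ?case by (intro simulation_Plus)
next
  case (4 cs)
  show ?case
  proof (cases "syn_deg (Times cs) = 0")
    case True
    then show ?thesis
      using simulates_exact_size_constant[of n "Times cs" deg x] 4
      by (simp del: syn_deg.simps formula_over_simps)
  next
    case False
    from 4 obtain f where "\<forall>c\<in>set cs. simulates deg x n (snd c) (f c)"
        "\<forall>c\<in>set cs. 2 ^ depth (f c) \<le> 8 ^ depth (snd c) * (max 1 (syn_deg (snd c)))\<^sup>2"
      unfolding formula_over_simps by metis
    with 4 False deg show ?thesis by (intro simulation_Times)
  qed
qed

text \<open>Stated for any monoid of monomials with additive \<open>deg\<close>, so that one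
  constant serves both polynomial rings.\<close>

lemma depth_reduction:
  fixes x :: "nat \<Rightarrow> 'm::monoid_add" and F :: "'a::field formula"
  assumes deg: "\<And>u v. deg (u + v) = deg u + deg v"
    and F: "formula_over n F" "syn_deg F \<ge> 1"
  shows "\<exists>F'. formula_over n F' \<and> polynomial_of x F' = polynomial_of x F \<and>
    num_leaves F' = num_leaves F \<and> real (depth F') \<le> 3 * (real (depth F) + log 2 (real (syn_deg F))) \<and>
    product_fanin_two F' \<and> (homogeneous x deg F \<longrightarrow> homogeneous x deg F') \<and>
    (monotone_formula x F \<longrightarrow> monotone_formula x F')"
proof -
  let ?d = "syn_deg F"
  obtain F' where F': "simulates deg x n F F'" "2 ^ depth F' \<le> 8 ^ depth F * (max 1 ?d)\<^sup>2"
    using ex_simulation[of deg n F x, OF deg F(1)] by blast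
  have "max 1 ?d = ?d" using F(2) by simp
  then have "(2::nat) ^ depth F' \<le> 2 ^ (3 * depth F) * ?d\<^sup>2"
    using F'(2) by (simp add: power_mult)
  then have "real (2 ^ depth F') \<le> real (2 ^ (3 * depth F) * ?d\<^sup>2)"
    by (rule of_nat_mono)
  then have "(2::real) ^ depth F' \<le> 2 ^ (3 * depth F) * (real ?d)\<^sup>2"
    by simp
  then have "log 2 (2 ^ depth F') \<le> log 2 (2 ^ (3 * depth F) * (real ?d)\<^sup>2)"
    by (intro log_mono) auto
  also have "\<dots> = 3 * real (depth F) + 2 * log 2 (real ?d)"
    using F(2) by (simp add: log_mult log_nat_power)
  finally have "real (depth F') \<le> 3 * real (depth F) + 2 * log 2 (real ?d)"
    by (simp add: log_nat_power)
  \<comment> \<open>As the logarithm is non-negative, its factor \<open>2\<close> can be raised to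
    the \<open>3 = log 2 8\<close> of the depth term.\<close>
  moreover have "log 2 (real ?d) \<ge> 0" using F(2) by simp
  ultimately have "real (depth F') \<le> 3 * (real (depth F) + log 2 (real ?d))" by argo
  then show ?thesis
    using F'(1) monotone_formula_transfer[OF _ F(1)] unfolding simulates_def by blast
qed

section \<open>The commutative and the non-commutative instance\<close>

text \<open>The three degrees are sums over different supports; each is extended by zeros to the
  union of the supports of \<open>u\<close> and \<open>v\<close>.\<close>

lemma c_degree_add: "c_degree (u + v) = c_degree u + c_degree v"
proof -
  have sum: "c_degree m = (\<Sum>i\<in>Poly_Mapping.keys u \<union> Poly_Mapping.keys v. Poly_Mapping.lookup m i)"
    if "Poly_Mapping.keys m \<subseteq> Poly_Mapping.keys u \<union> Poly_Mapping.keys v" for m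
    unfolding c_degree_def
    by (rule sum.mono_neutral_left) (use that in \<open>auto simp: in_keys_iff\<close>)
  show ?thesis
    using sum[of u] sum[of v] sum[of "u + v"] Poly_Mapping.keys_add[of u v]
    by (simp add: lookup_add sum.distrib)
qed

lemma nc_degree_add: "nc_degree (u + v) = nc_degree u + nc_degree v"
  by (simp add: nc_degree_def plus_nc_monomial_def)

theorem theorem3p7:
  "\<exists>C::real.
     (\<forall>(n::nat) (F :: 'a::field formula) P s \<Delta> d.
        formula_over n F \<and> polynomial_of c_var F = P \<and>
        num_leaves F = s \<and> depth F = \<Delta> \<and> syn_deg F = d \<and> d \<ge> 1 \<longrightarrow>
        (\<exists>F'. formula_over n F' \<and> polynomial_of c_var F' = P \<and>
           num_leaves F' = s \<and> real (depth F') \<le> C * (real \<Delta> + log 2 (real d)) \<and>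
           product_fanin_two F' \<and>
           (homogeneous c_var c_degree F \<longrightarrow> homogeneous c_var c_degree F') \<and>
           (monotone_formula c_var F \<longrightarrow> monotone_formula c_var F')))
   \<and> (\<forall>(n::nat) (F :: 'a::field formula) P s \<Delta> d.
        formula_over n F \<and> polynomial_of nc_var F = P \<and>
        num_leaves F = s \<and> depth F = \<Delta> \<and> syn_deg F = d \<and> d \<ge> 1 \<longrightarrow>
        (\<exists>F'. formula_over n F' \<and> polynomial_of nc_var F' = P \<and>
           num_leaves F' = s \<and> real (depth F') \<le> C * (real \<Delta> + log 2 (real d)) \<and>
           product_fanin_two F' \<and>
           (homogeneous nc_var nc_degree F \<longrightarrow> homogeneous nc_var nc_degree F') \<and>
           (monotone_formula nc_var F \<longrightarrow> monotone_formula nc_var F')))"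
proof (intro exI[of _ 3] conjI allI impI; elim conjE; hypsubst)
  fix n and F :: "'a formula"
  assume F: "formula_over n F" "syn_deg F \<ge> 1"
  show "\<exists>F'. formula_over n F' \<and> polynomial_of c_var F' = polynomial_of c_var F \<and>
      num_leaves F' = num_leaves F \<and> real (depth F') \<le> 3 * (real (depth F) + log 2 (real (syn_deg F))) \<and>
      product_fanin_two F' \<and> (homogeneous c_var c_degree F \<longrightarrow> homogeneous c_var c_degree F') \<and>
      (monotone_formula c_var F \<longrightarrow> monotone_formula c_var F')"
    by (rule depth_reduction[of c_degree n F c_var, OF c_degree_add F])
  show "\<exists>F'. formula_over n F' \<and> polynomial_of nc_var F' = polynomial_of nc_var F \<and>
      num_leaves F' = num_leaves F \<and> real (depth F') \<le> 3 * (real (depth F) + log 2 (real (syn_deg F))) \<and>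
      product_fanin_two F' \<and> (homogeneous nc_var nc_degree F \<longrightarrow> homogeneous nc_var nc_degree F') \<and>
      (monotone_formula nc_var F \<longrightarrow> monotone_formula nc_var F')"
    by (rule depth_reduction[of nc_degree n F nc_var, OF nc_degree_add F])
qed

end
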